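(* Let $\mathsf{C}$ be a category of groups with operations, let $(A,B,\alpha)$ be a crossed module in $\mathsf{C}$ and let $d\in\operatorname{Der}_{\alpha}(B,A)$ be a derivation. Then the following are equivalent: (a) $d\in\operatorname{D}_{\alpha}(B,A)$, i.e. $d$ is a regular derivation; (b) $\theta_d\in\operatorname{Aut}(A)$; (c) $\sigma_d\in\operatorname{Aut}(B)$.
   Context: Category of groups with operations. $\mathsf{C}$ is a category of groups with a set of operations $\Omega=\Omega_0\cup\Omega_1\cup\Omega_2$ ($\Omega_i$ the $i$-ary operations) and a set $E$ of identities including the group laws; i.e. objects are all algebras with operations $\Omega$ satisfying $E$. The group operations are written additively (not assumed commutative): $0\in\Omega_0$, $-\in\Omega_1$, $+\in\Omega_2$, and $\Omega_0=\{0\}$. Put $\Omega_2'=\Omega_2\setminus\{+\}$, $\Omega_1'=\Omega_1\setminus\{-\}$. If $*\in\Omega_2'$ then the operation $*^{\circ}$ defined by $a*^{\circ}b=b*a$ is also in $\Omega_2'$. $E$ includes $a*(b+c)=a*b+a*c$, $\omega(a+b)=\omega(a)+\omega(b)$ and $\omega(a)*b=\omega(a*b)$ for all $*\in\Omega_2'$, $\omega\in\Omega_1'$. Morphisms are group homomorphisms preserving all operations in $\Omega_1$ and $\Omega_2$. $\operatorname{Aut}(X)$ denotes the group of automorphisms of $X$ in $\mathsf{C}$. Derived actions. Given a split extension $0\to A\xrightarrow{\imath} E\xrightarrow{p} B\to 0$ in $\mathsf{C}$ ($p$ surjective, $\imath$ the kernel of $p$) with section $s\colon B\to E$ a morphism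 in $\mathsf{C}$, $ps=1_B$, one gets actions $b\cdot a=s(b)+a-s(b)$ and $b*a=s(b)*a$ (for each $*\in\Omega_2'$) of $B$ on $A$; sets of actions arising in this way are called sets of derived actions. One writes $a*b$ for $b*^{\circ}a$. Crossed modules. A crossed module $(A,B,\alpha)$ in $\mathsf{C}$ is a morphism $\alpha\colon A\to B$ in $\mathsf{C}$ with a set of derived actions of $B$ on $A$ such that for all $a,a_1\in A$, $b\in B$, $*\in\Omega_2'$: (CM1) $\alpha(b\cdot a)=b+\alpha(a)-b$; (CM2) $\alpha(a)\cdot a_1=a+a_1-a$; (CM3) $\alpha(b*a)=b*\alpha(a)$, $\alpha(a*b)=\alpha(a)*b$; (CM4) $\alpha(a)*a_1=a*a_1=a*\alpha(a_1)$. Derivations. A function $d\colon B\to A$ is a derivation of $(A,B,\alpha)$ if for all $b,b_1\in B$, $*\in\Omega_2'$, $\omega\in\Omega_1'$: $d(b+b_1)=d(b)+b\cdot d(b_1)$; $d(b*b_1)=d(b)*d(b_1)+d(b)*b_1+b*d(b_1)$; $d(\omega(b))=\omega(d(b))$. $\operatorname{Der}_{\alpha}(B,A)$ is the set of all derivations. For a derivation $d$, put $\theta_d(a)=d(\alpha(a))+a$ for $a\in A$ and $\sigma_d(b)=\alpha(d(b))+b$ for $b\in B$; these are endomorphisms of $A$ and $B$ in $\mathsf{C}$. Derivations are multiplied by $(d_1\circ d_2)(b)=d_1(\sigma_{d_2}(b))+d_2(b)$, equivalently $(d_1\circ d_2)(b)=\theta_{d_1}(d_2(b))+d_1(b)$;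 the identity element is the zero map $0\colon B\to A$. A derivation is regular if it has an inverse in $\operatorname{Der}_{\alpha}(B,A)$ with respect to $\circ$. $\operatorname{D}_{\alpha}(B,A)$ denotes the group of regular derivations (the Whitehead group). *)

theory Defs
  imports "HOL-Algebra.Group"
begin

section \<open>Categories of groups with operations\<close>

text \<open>
  Terms over the operation symbols.  The constructors \<open>Zero\<close>, \<open>Neg\<close>, \<open>Plus\<close> are the group
  operations (written additively, not assumed commutative); \<open>Zero\<close> is the only nullary
  operation.  \<open>Unop\<close> and \<open>Binop\<close> carry the symbols of the remaining unary operations
  (\<open>\<Omega>\<^sub>1'\<close>) and the remaining binary operations (\<open>\<Omega>\<^sub>2'\<close>).
\<close>

datatype ('u, 'v) gterm =
    Var nat
  | Zero
  | Neg "('u, 'v) gterm"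
  | Plus "('u, 'v) gterm" "('u, 'v) gterm"
  | Unop 'u "('u, 'v) gterm"
  | Binop 'v "('u, 'v) gterm" "('u, 'v) gterm"

text \<open>
  The symbol sets are sets rather than types, so that each of them may be empty
  (for the category of groups both are).  \<open>opp\<close> is the map sending \<open>*\<close> to its opposite \<open>*\<degree>\<close>.
\<close>

record ('u, 'v) op_theory =
  unops :: "'u set"
  binops :: "'v set"
  opp :: "'v \<Rightarrow> 'v"
  identities :: "(('u, 'v) gterm \<times> ('u, 'v) gterm) set"

fun over_signature :: "('u, 'v) op_theory \<Rightarrow> ('u, 'v) gterm \<Rightarrow> bool" where
  "over_signature C (Var n) \<longleftrightarrow> True"
| "over_signature C Zero \<longleftrightarrow> True"
| "over_signature C (Neg t) \<longleftrightarrow> over_signature C t"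
| "over_signature C (Plus t u) \<longleftrightarrow> over_signature C t \<and> over_signature C u"
| "over_signature C (Unop \<omega> t) \<longleftrightarrow> \<omega> \<in> unops C \<and> over_signature C t"
| "over_signature C (Binop m t u) \<longleftrightarrow> m \<in> binops C \<and> over_signature C t \<and> over_signature C u"

definition group_laws :: "(('u, 'v) gterm \<times> ('u, 'v) gterm) set" where
  "group_laws = (let x = Var 0; y = Var 1; z = Var 2 in
     {(Plus (Plus x y) z, Plus x (Plus y z)),
      (Plus Zero x, x), (Plus x Zero, x),
      (Plus (Neg x) x, Zero), (Plus x (Neg x), Zero)})"

definition opposite_laws :: "('u, 'v) op_theory \<Rightarrow> (('u, 'v) gterm \<times> ('u, 'v) gterm) set" where
  "opposite_laws C = (let x = Var 0; y = Var 1 in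
     {(Binop (opp C m) x y, Binop m y x) | m. m \<in> binops C})"

definition distributive_laws :: "('u, 'v) op_theory \<Rightarrow> (('u, 'v) gterm \<times> ('u, 'v) gterm) set" where
  "distributive_laws C = (let x = Var 0; y = Var 1; z = Var 2 in
     {(Binop m x (Plus y z), Plus (Binop m x y) (Binop m x z)) | m. m \<in> binops C})"

definition unary_additive_laws :: "('u, 'v) op_theory \<Rightarrow> (('u, 'v) gterm \<times> ('u, 'v) gterm) set" where
  "unary_additive_laws C = (let x = Var 0; y = Var 1 in
     {(Unop \<omega> (Plus x y), Plus (Unop \<omega> x) (Unop \<omega> y)) | \<omega>. \<omega> \<in> unops C})"

definition unary_binary_laws :: "('u, 'v) op_theory \<Rightarrow> (('u, 'v) gterm \<times> ('u, 'v) gterm) set" where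
  "unary_binary_laws C = (let x = Var 0; y = Var 1 in
     {(Binop m (Unop \<omega> x) y, Unop \<omega> (Binop m x y)) | \<omega> m. \<omega> \<in> unops C \<and> m \<in> binops C})"

definition groups_with_operations :: "('u, 'v) op_theory \<Rightarrow> bool" where
  "groups_with_operations C \<longleftrightarrow>
     (\<forall>m \<in> binops C. opp C m \<in> binops C) \<and>
     (\<forall>(t, u) \<in> identities C. over_signature C t \<and> over_signature C u) \<and>
     group_laws \<subseteq> identities C \<and>
     opposite_laws C \<subseteq> identities C \<and>
     distributive_laws C \<subseteq> identities C \<and>
     unary_additive_laws C \<subseteq> identities C \<and>
     unary_binary_laws C \<subseteq> identities C"


section \<open>Objects and morphisms\<close>

record ('a, 'u, 'v) galgebra = "'a partial_object" +
  gzero :: 'a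
  gneg :: "'a \<Rightarrow> 'a" ("\<boxminus>\<index> _" [81] 80)
  gplus :: "'a \<Rightarrow> 'a \<Rightarrow> 'a" (infixl "\<boxplus>\<index>" 65)
  gun :: "'u \<Rightarrow> 'a \<Rightarrow> 'a"
  gbin :: "'v \<Rightarrow> 'a \<Rightarrow> 'a \<Rightarrow> 'a"

fun eval_term :: "('a, 'u, 'v) galgebra \<Rightarrow> (nat \<Rightarrow> 'a) \<Rightarrow> ('u, 'v) gterm \<Rightarrow> 'a" where
  "eval_term X v (Var n) = v n"
| "eval_term X v Zero = gzero X"
| "eval_term X v (Neg t) = \<boxminus>\<^bsub>X\<^esub> (eval_term X v t)"
| "eval_term X v (Plus t u) = eval_term X v t \<boxplus>\<^bsub>X\<^esub> eval_term X v u"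
| "eval_term X v (Unop \<omega> t) = gun X \<omega> (eval_term X v t)"
| "eval_term X v (Binop m t u) = gbin X m (eval_term X v t) (eval_term X v u)"

definition is_object :: "('u, 'v) op_theory \<Rightarrow> ('a, 'u, 'v) galgebra \<Rightarrow> bool" where
  "is_object C X \<longleftrightarrow>
     gzero X \<in> carrier X \<and>
     (\<forall>x \<in> carrier X. \<boxminus>\<^bsub>X\<^esub> x \<in> carrier X) \<and>
     (\<forall>x \<in> carrier X. \<forall>y \<in> carrier X. x \<boxplus>\<^bsub>X\<^esub> y \<in> carrier X) \<and>
     (\<forall>\<omega> \<in> unops C. \<forall>x \<in> carrier X. gun X \<omega> x \<in> carrier X) \<and>
     (\<forall>m \<in> binops C. \<forall>x \<in> carrier X. \<forall>y \<in> carrier X. gbin X m x y \<in> carrier X) \<and>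
     (\<forall>(t, u) \<in> identities C. \<forall>v. range v \<subseteq> carrier X \<longrightarrow> eval_term X v t = eval_term X v u)"

text \<open>
  Maps between carriers are taken extensional (\<open>undefined\<close> off the carrier), so that equality
  of HOL functions is equality of maps.
\<close>

definition gwo_hom ::
  "('u, 'v) op_theory \<Rightarrow> ('a, 'u, 'v) galgebra \<Rightarrow> ('b, 'u, 'v) galgebra \<Rightarrow> ('a \<Rightarrow> 'b) set" where
  "gwo_hom C X Y = {f \<in> carrier X \<rightarrow>\<^sub>E carrier Y.
     (\<forall>x \<in> carrier X. \<forall>y \<in> carrier X. f (x \<boxplus>\<^bsub>X\<^esub> y) = f x \<boxplus>\<^bsub>Y\<^esub> f y) \<and>
     (\<forall>x \<in> carrier X. f (\<boxminus>\<^bsub>X\<^esub> x) = \<boxminus>\<^bsub>Y\<^esub> (f x)) \<and>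
     (\<forall>\<omega> \<in> unops C. \<forall>x \<in> carrier X. f (gun X \<omega> x) = gun Y \<omega> (f x)) \<and>
     (\<forall>m \<in> binops C. \<forall>x \<in> carrier X. \<forall>y \<in> carrier X. f (gbin X m x y) = gbin Y m (f x) (f y))}"

definition End_monoid :: "('u, 'v) op_theory \<Rightarrow> ('a, 'u, 'v) galgebra \<Rightarrow> ('a \<Rightarrow> 'a) monoid" where
  "End_monoid C X =
     \<lparr>carrier = gwo_hom C X X,
      mult = (\<lambda>f g. compose (carrier X) f g),
      one = (\<lambda>x \<in> carrier X. x)\<rparr>"

definition Aut :: "('u, 'v) op_theory \<Rightarrow> ('a, 'u, 'v) galgebra \<Rightarrow> ('a \<Rightarrow> 'a) monoid" where
  "Aut C X = units_of (End_monoid C X)"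


section \<open>Derived actions and crossed modules\<close>

definition split_extension ::
  "('u, 'v) op_theory \<Rightarrow> ('a, 'u, 'v) galgebra \<Rightarrow> ('e, 'u, 'v) galgebra \<Rightarrow> ('b, 'u, 'v) galgebra \<Rightarrow>
   ('a \<Rightarrow> 'e) \<Rightarrow> ('e \<Rightarrow> 'b) \<Rightarrow> ('b \<Rightarrow> 'e) \<Rightarrow> bool" where
  "split_extension C A E B i p s \<longleftrightarrow>
     is_object C A \<and> is_object C E \<and> is_object C B \<and>
     i \<in> gwo_hom C A E \<and> p \<in> gwo_hom C E B \<and> s \<in> gwo_hom C B E \<and>
     inj_on i (carrier A) \<and>
     i ` carrier A = {e \<in> carrier E. p e = gzero B} \<and>
     p ` carrier E = carrier B \<and>
     (\<forall>b \<in> carrier B. p (s b) = b)"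

text \<open>
  A set of actions of \<open>B\<close> on \<open>A\<close> is a pair of maps \<open>dot\<close> and \<open>star\<close>: \<open>dot b a\<close> is \<open>b \<cdot> a\<close>, and
  \<open>star m b a\<close> is \<open>b * a\<close> for the symbol \<open>m\<close> of \<open>*\<close>.  Since \<open>A\<close> is identified with its image
  in the extension, the defining equations are stated after applying \<open>i\<close>.

  A definition in HOL cannot quantify existentially over the type of elements of the
  extension, so this type is the parameter \<open>'e\<close>.  A theorem that assumes
  \<open>derived_actions TYPE('e) \<dots>\<close> for a type variable \<open>'e\<close> applies to extensions of every type.
\<close>

definition derived_actions ::
  "'e itself \<Rightarrow> ('u, 'v) op_theory \<Rightarrow> ('a, 'u, 'v) galgebra \<Rightarrow> ('b, 'u, 'v) galgebra \<Rightarrow>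
   ('b \<Rightarrow> 'a \<Rightarrow> 'a) \<Rightarrow> ('v \<Rightarrow> 'b \<Rightarrow> 'a \<Rightarrow> 'a) \<Rightarrow> bool" where
  "derived_actions TYPE('e) C A B dot star \<longleftrightarrow>
     (\<exists>(E :: ('e, 'u, 'v) galgebra) i p s.
        split_extension C A E B i p s \<and>
        (\<forall>b \<in> carrier B. \<forall>a \<in> carrier A.
           dot b a \<in> carrier A \<and>
           i (dot b a) = s b \<boxplus>\<^bsub>E\<^esub> i a \<boxplus>\<^bsub>E\<^esub> (\<boxminus>\<^bsub>E\<^esub> (s b))) \<and>
        (\<forall>m \<in> binops C. \<forall>b \<in> carrier B. \<forall>a \<in> carrier A.
           star m b a \<in> carrier A \<and>
           i (star m b a) = gbin E m (s b) (i a)))"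

text \<open>\<open>a * b\<close>, for \<open>a\<close> in \<open>A\<close> and \<open>b\<close> in \<open>B\<close>, is notation for \<open>b *\<degree> a\<close>.\<close>

definition rstar ::
  "('u, 'v) op_theory \<Rightarrow> ('v \<Rightarrow> 'b \<Rightarrow> 'a \<Rightarrow> 'a) \<Rightarrow> 'v \<Rightarrow> 'a \<Rightarrow> 'b \<Rightarrow> 'a" where
  "rstar C star m a b = star (opp C m) b a"

definition crossed_module ::
  "'e itself \<Rightarrow> ('u, 'v) op_theory \<Rightarrow> ('a, 'u, 'v) galgebra \<Rightarrow> ('b, 'u, 'v) galgebra \<Rightarrow> ('a \<Rightarrow> 'b) \<Rightarrow>
   ('b \<Rightarrow> 'a \<Rightarrow> 'a) \<Rightarrow> ('v \<Rightarrow> 'b \<Rightarrow> 'a \<Rightarrow> 'a) \<Rightarrow> bool" where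
  "crossed_module TYPE('e) C A B \<alpha> dot star \<longleftrightarrow>
     is_object C A \<and> is_object C B \<and> \<alpha> \<in> gwo_hom C A B \<and>
     derived_actions TYPE('e) C A B dot star \<and>
     (\<forall>a \<in> carrier A. \<forall>b \<in> carrier B.
        \<alpha> (dot b a) = b \<boxplus>\<^bsub>B\<^esub> \<alpha> a \<boxplus>\<^bsub>B\<^esub> (\<boxminus>\<^bsub>B\<^esub> b)) \<and>
     (\<forall>a \<in> carrier A. \<forall>a1 \<in> carrier A.
        dot (\<alpha> a) a1 = a \<boxplus>\<^bsub>A\<^esub> a1 \<boxplus>\<^bsub>A\<^esub> (\<boxminus>\<^bsub>A\<^esub> a)) \<and>
     (\<forall>m \<in> binops C. \<forall>a \<in> carrier A. \<forall>b \<in> carrier B.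
        \<alpha> (star m b a) = gbin B m b (\<alpha> a) \<and>
        \<alpha> (rstar C star m a b) = gbin B m (\<alpha> a) b) \<and>
     (\<forall>m \<in> binops C. \<forall>a \<in> carrier A. \<forall>a1 \<in> carrier A.
        star m (\<alpha> a) a1 = gbin A m a a1 \<and>
        gbin A m a a1 = rstar C star m a (\<alpha> a1))"


section \<open>Derivations and the Whitehead group\<close>

definition Der ::
  "('u, 'v) op_theory \<Rightarrow> ('a, 'u, 'v) galgebra \<Rightarrow> ('b, 'u, 'v) galgebra \<Rightarrow>
   ('b \<Rightarrow> 'a \<Rightarrow> 'a) \<Rightarrow> ('v \<Rightarrow> 'b \<Rightarrow> 'a \<Rightarrow> 'a) \<Rightarrow> ('b \<Rightarrow> 'a) set" where
  "Der C A B dot star = {d \<in> carrier B \<rightarrow>\<^sub>E carrier A.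
     (\<forall>b \<in> carrier B. \<forall>b1 \<in> carrier B. d (b \<boxplus>\<^bsub>B\<^esub> b1) = d b \<boxplus>\<^bsub>A\<^esub> dot b (d b1)) \<and>
     (\<forall>m \<in> binops C. \<forall>b \<in> carrier B. \<forall>b1 \<in> carrier B.
        d (gbin B m b b1) =
          gbin A m (d b) (d b1) \<boxplus>\<^bsub>A\<^esub> rstar C star m (d b) b1 \<boxplus>\<^bsub>A\<^esub> star m b (d b1)) \<and>
     (\<forall>\<omega> \<in> unops C. \<forall>b \<in> carrier B. d (gun B \<omega> b) = gun A \<omega> (d b))}"

definition \<theta> :: "('a, 'u, 'v) galgebra \<Rightarrow> ('a \<Rightarrow> 'b) \<Rightarrow> ('b \<Rightarrow> 'a) \<Rightarrow> 'a \<Rightarrow> 'a" where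
  "\<theta> A \<alpha> d = (\<lambda>a \<in> carrier A. d (\<alpha> a) \<boxplus>\<^bsub>A\<^esub> a)"

definition \<sigma> :: "('b, 'u, 'v) galgebra \<Rightarrow> ('a \<Rightarrow> 'b) \<Rightarrow> ('b \<Rightarrow> 'a) \<Rightarrow> 'b \<Rightarrow> 'b" where
  "\<sigma> B \<alpha> d = (\<lambda>b \<in> carrier B. \<alpha> (d b) \<boxplus>\<^bsub>B\<^esub> b)"

definition Der_monoid ::
  "('u, 'v) op_theory \<Rightarrow> ('a, 'u, 'v) galgebra \<Rightarrow> ('b, 'u, 'v) galgebra \<Rightarrow> ('a \<Rightarrow> 'b) \<Rightarrow>
   ('b \<Rightarrow> 'a \<Rightarrow> 'a) \<Rightarrow> ('v \<Rightarrow> 'b \<Rightarrow> 'a \<Rightarrow> 'a) \<Rightarrow> ('b \<Rightarrow> 'a) monoid" where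
  "Der_monoid C A B \<alpha> dot star =
     \<lparr>carrier = Der C A B dot star,
      mult = (\<lambda>d1 d2. \<lambda>b \<in> carrier B. d1 (\<sigma> B \<alpha> d2 b) \<boxplus>\<^bsub>A\<^esub> d2 b),
      one = (\<lambda>b \<in> carrier B. gzero A)\<rparr>"

definition Whitehead_group ::
  "('u, 'v) op_theory \<Rightarrow> ('a, 'u, 'v) galgebra \<Rightarrow> ('b, 'u, 'v) galgebra \<Rightarrow> ('a \<Rightarrow> 'b) \<Rightarrow>
   ('b \<Rightarrow> 'a \<Rightarrow> 'a) \<Rightarrow> ('v \<Rightarrow> 'b \<Rightarrow> 'a \<Rightarrow> 'a) \<Rightarrow> ('b \<Rightarrow> 'a) monoid" where
  "Whitehead_group C A B \<alpha> dot star = units_of (Der_monoid C A B \<alpha> dot star)"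

end

theory Submission
  imports Defs
begin

text \<open>
  The proof runs (c) \<open>\<Longrightarrow>\<close> (b) \<open>\<Longrightarrow>\<close> (a) \<open>\<Longrightarrow>\<close> (c).  The implication (a) \<open>\<Longrightarrow>\<close> (c) holds because
  \<open>d \<mapsto> \<sigma>\<^sub>d\<close> turns \<open>\<circ>\<close> into composition and the zero derivation into the identity
  (\<open>\<sigma>_mult\<close>, \<open>\<sigma>_zero\<close>), so that it sends inverse derivations to inverse endomorphisms.

  For (c) \<open>\<Longrightarrow>\<close> (b) it suffices that \<open>\<theta>\<^sub>d\<close> is bijective (\<open>\<theta>_bij_if_\<sigma>_bij\<close>).  If \<open>\<theta>\<^sub>d a = 0\<close> then
  \<open>\<sigma>\<^sub>d\<close> kills \<open>\<alpha> a\<close>, so \<open>\<alpha> a = 0\<close> and \<open>a = - d 0 = 0\<close>.  If \<open>\<alpha> a = \<sigma>\<^sub>d b\<close> then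
  \<open>b = \<alpha> (- d b + a)\<close>, and \<open>\<theta>\<^sub>d\<close> maps \<open>- d b + a\<close> to \<open>a\<close>.

  For (b) \<open>\<Longrightarrow>\<close> (a), the formula \<open>(d \<circ> d') b = \<theta>\<^sub>d (d' b) + d b\<close> leaves only one candidate for the
  inverse, \<open>d' b = \<theta>\<^sub>d\<inverse> (- d b)\<close>.  It is a two-sided inverse as soon as it is a derivation, because
  \<open>\<theta>\<^sub>d \<circ> d = d \<circ> \<sigma>\<^sub>d\<close>.  After applying the injective map \<open>\<theta>\<^sub>d\<close>, the derivation laws
  for \<open>d'\<close> become statements about \<open>d\<close>, by means of
  \<open>\<theta>\<^sub>d (b \<cdot> a) = d b + b \<cdot> \<theta>\<^sub>d a - d b\<close> and \<open>\<theta>\<^sub>d (b * a) = d b * \<theta>\<^sub>d a + b * \<theta>\<^sub>d a\<close>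
  (\<open>\<theta>_dot\<close>, \<open>\<theta>_star\<close>).  The law for \<open>*\<close> then asks for a rearrangement of summands, which is
  possible although \<open>+\<close> need not be commutative: two-sided distributivity forces any two values
  of \<open>*\<close> to commute under \<open>+\<close> (\<open>bin_commute\<close>), in particular in the split extension that
  defines the actions.
\<close>

section \<open>Arithmetic in an object\<close>

locale gwo_object =
  fixes C :: "('u, 'v) op_theory" and X :: "('a, 'u, 'v) galgebra" (structure)
  assumes gwo: "groups_with_operations C" and object: "is_object C X"
begin

lemma closed [simp]:
  "gzero X \<in> carrier X"
  "x \<in> carrier X \<Longrightarrow> \<boxminus> x \<in> carrier X"
  "x \<in> carrier X \<Longrightarrow> y \<in> carrier X \<Longrightarrow> x \<boxplus> y \<in> carrier X"
  "\<omega> \<in> unops C \<Longrightarrow> x \<in> carrier X \<Longrightarrow> gun X \<omega> x \<in> carrier X"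
  "m \<in> binops C \<Longrightarrow> x \<in> carrier X \<Longrightarrow> y \<in> carrier X \<Longrightarrow> gbin X m x y \<in> carrier X"
  using object by (auto simp: is_object_def)

lemma opp_closed [simp]: "m \<in> binops C \<Longrightarrow> opp C m \<in> binops C"
  using gwo by (simp add: groups_with_operations_def)

lemma identity_holds:
  assumes "(t, u) \<in> identities C" and "x \<in> carrier X" "y \<in> carrier X" "z \<in> carrier X"
  shows "eval_term X ((\<lambda>_. z)(0 := x, 1 := y)) t = eval_term X ((\<lambda>_. z)(0 := x, 1 := y)) u"
proof -
  have "range ((\<lambda>_::nat. z)(0 := x, 1 := y)) \<subseteq> carrier X"
    using assms by auto
  then show ?thesis
    using object assms(1) unfolding is_object_def by blast
qed

lemma group_law:
  "(t, u) \<in> group_laws \<Longrightarrow> (t, u) \<in> identities C"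
  using gwo by (auto simp: groups_with_operations_def)

lemma assoc [simp]:
  assumes "x \<in> carrier X" "y \<in> carrier X" "z \<in> carrier X"
  shows "(x \<boxplus> y) \<boxplus> z = x \<boxplus> (y \<boxplus> z)"
  using identity_holds[OF group_law assms, of "Plus (Plus (Var 0) (Var 1)) (Var 2)"
      "Plus (Var 0) (Plus (Var 1) (Var 2))"]
  by (simp add: group_laws_def Let_def)

lemma zero_neg [simp]:
  assumes "x \<in> carrier X"
  shows "gzero X \<boxplus> x = x" "x \<boxplus> gzero X = x" "(\<boxminus> x) \<boxplus> x = gzero X" "x \<boxplus> (\<boxminus> x) = gzero X"
  using identity_holds[OF group_law assms assms assms, of "Plus Zero (Var 0)" "Var 0"]
    identity_holds[OF group_law assms assms assms, of "Plus (Var 0) Zero" "Var 0"]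
    identity_holds[OF group_law assms assms assms, of "Plus (Neg (Var 0)) (Var 0)" "Zero"]
    identity_holds[OF group_law assms assms assms, of "Plus (Var 0) (Neg (Var 0))" "Zero"]
  by (simp_all add: group_laws_def Let_def)

text \<open>
  Together with associativity, the laws of \<open>0\<close> and the rules for \<open>-\<close> below, these equations
  rewrite every word to a reduced word, so that the simplifier decides equations that follow from
  the group laws alone.
\<close>

lemma neg_cancel [simp]:
  assumes "x \<in> carrier X" "y \<in> carrier X"
  shows "(\<boxminus> x) \<boxplus> (x \<boxplus> y) = y" "x \<boxplus> ((\<boxminus> x) \<boxplus> y) = y"
  using assms by (simp_all flip: assoc)

lemma left_cancel [simp]:
  assumes "x \<in> carrier X" "y \<in> carrier X" "z \<in> carrier X"
  shows "x \<boxplus> y = x \<boxplus> z \<longleftrightarrow> y = z"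
  using assms by (metis neg_cancel(1))

lemma right_cancel [simp]:
  assumes "x \<in> carrier X" "y \<in> carrier X" "z \<in> carrier X"
  shows "y \<boxplus> x = z \<boxplus> x \<longleftrightarrow> y = z"
  using assms by (metis assoc closed(2) zero_neg(2,4))

lemma neg_unique:
  assumes "x \<in> carrier X" "y \<in> carrier X" "x \<boxplus> y = gzero X"
  shows "y = \<boxminus> x"
  using assms by (metis closed(2) left_cancel zero_neg(4))

lemma neg_neg [simp]: "x \<in> carrier X \<Longrightarrow> \<boxminus> (\<boxminus> x) = x"
  by (rule neg_unique[symmetric]) auto

lemma neg_plus [simp]:
  "x \<in> carrier X \<Longrightarrow> y \<in> carrier X \<Longrightarrow> \<boxminus> (x \<boxplus> y) = (\<boxminus> y) \<boxplus> (\<boxminus> x)"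
  by (rule neg_unique[symmetric]) auto

lemma neg_zero [simp]: "\<boxminus> (gzero X) = gzero X"
  by (rule neg_unique[symmetric]) auto

lemma idempotent_zero:
  "x \<in> carrier X \<Longrightarrow> x \<boxplus> x = x \<Longrightarrow> x = gzero X"
  by (metis closed(1) left_cancel zero_neg(2))

lemma additive_neg:
  assumes f: "\<And>x y. x \<in> carrier X \<Longrightarrow> y \<in> carrier X \<Longrightarrow> f (x \<boxplus> y) = f x \<boxplus> f y"
    and closed_f: "\<And>x. x \<in> carrier X \<Longrightarrow> f x \<in> carrier X" and x: "x \<in> carrier X"
  shows "f (\<boxminus> x) = \<boxminus> (f x)"
proof -
  have "f (gzero X) = gzero X"
    using f[of "gzero X" "gzero X"] closed_f by (intro idempotent_zero) auto
  then have "f x \<boxplus> f (\<boxminus> x) = gzero X"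
    using f[of x "\<boxminus> x"] x by simp
  then show ?thesis
    using x closed_f by (intro neg_unique) auto
qed

lemma opp_bin:
  assumes "m \<in> binops C" "x \<in> carrier X" "y \<in> carrier X"
  shows "gbin X (opp C m) x y = gbin X m y x"
proof -
  have "(Binop (opp C m) (Var 0) (Var 1), Binop m (Var 1) (Var 0)) \<in> identities C"
    using gwo assms(1) by (auto simp: groups_with_operations_def opposite_laws_def Let_def)
  from identity_holds[OF this assms(2,3,3)] show ?thesis by simp
qed

lemma bin_add_right [simp]:
  assumes "m \<in> binops C" "x \<in> carrier X" "y \<in> carrier X" "z \<in> carrier X"
  shows "gbin X m x (y \<boxplus> z) = gbin X m x y \<boxplus> gbin X m x z"
proof -
  have "(Binop m (Var 0) (Plus (Var 1) (Var 2)),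
      Plus (Binop m (Var 0) (Var 1)) (Binop m (Var 0) (Var 2))) \<in> identities C"
    using gwo assms(1) by (auto simp: groups_with_operations_def distributive_laws_def Let_def)
  from identity_holds[OF this assms(2-)] show ?thesis by simp
qed

lemma bin_add_left [simp]:
  assumes "m \<in> binops C" "x \<in> carrier X" "y \<in> carrier X" "z \<in> carrier X"
  shows "gbin X m (x \<boxplus> y) z = gbin X m x z \<boxplus> gbin X m y z"
  using assms opp_bin[of m z "x \<boxplus> y"] opp_bin[of m z x] opp_bin[of m z y]
    bin_add_right[of "opp C m" z x y] by simp

lemma un_add [simp]:
  assumes "\<omega> \<in> unops C" "x \<in> carrier X" "y \<in> carrier X"
  shows "gun X \<omega> (x \<boxplus> y) = gun X \<omega> x \<boxplus> gun X \<omega> y"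
proof -
  have "(Unop \<omega> (Plus (Var 0) (Var 1)), Plus (Unop \<omega> (Var 0)) (Unop \<omega> (Var 1))) \<in> identities C"
    using gwo assms(1) by (auto simp: groups_with_operations_def unary_additive_laws_def Let_def)
  from identity_holds[OF this assms(2,3,3)] show ?thesis by simp
qed

lemma bin_neg [simp]:
  assumes "m \<in> binops C" "x \<in> carrier X" "y \<in> carrier X"
  shows "gbin X m x (\<boxminus> y) = \<boxminus> (gbin X m x y)" "gbin X m (\<boxminus> x) y = \<boxminus> (gbin X m x y)"
  using additive_neg[of "gbin X m x" y] additive_neg[of "\<lambda>u. gbin X m u y" x] assms by simp_all

lemma un_neg [simp]:
  assumes "\<omega> \<in> unops C" "x \<in> carrier X"
  shows "gun X \<omega> (\<boxminus> x) = \<boxminus> (gun X \<omega> x)"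
  using additive_neg[of "gun X \<omega>" x] assms by simp

text \<open>
  Expanding \<open>(x + x') * (y + y')\<close> by the left law first and by the right law first gives
  the same four summands with the two middle ones exchanged.
\<close>

lemma bin_commute:
  assumes "m \<in> binops C" "x \<in> carrier X" "x' \<in> carrier X" "y \<in> carrier X" "y' \<in> carrier X"
  shows "gbin X m x y' \<boxplus> gbin X m x' y = gbin X m x' y \<boxplus> gbin X m x y'"
proof -
  have "gbin X m x y \<boxplus> (gbin X m x y' \<boxplus> (gbin X m x' y \<boxplus> gbin X m x' y')) =
      gbin X m (x \<boxplus> x') (y \<boxplus> y')"
    using assms by (subst bin_add_left) auto
  also have "\<dots> = gbin X m x y \<boxplus> (gbin X m x' y \<boxplus> (gbin X m x y' \<boxplus> gbin X m x' y'))"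
    using assms by (subst bin_add_right) auto
  finally have "(gbin X m x y' \<boxplus> gbin X m x' y) \<boxplus> gbin X m x' y' =
      (gbin X m x' y \<boxplus> gbin X m x y') \<boxplus> gbin X m x' y'"
    using assms by simp
  then show ?thesis
    using assms by (subst (asm) right_cancel) auto
qed


section \<open>Endomorphisms and automorphisms\<close>

lemma endomorphismI:
  assumes ext: "f \<in> carrier X \<rightarrow>\<^sub>E carrier X"
    and add: "\<And>x y. x \<in> carrier X \<Longrightarrow> y \<in> carrier X \<Longrightarrow> f (x \<boxplus> y) = f x \<boxplus> f y"
    and "\<And>\<omega> x. \<omega> \<in> unops C \<Longrightarrow> x \<in> carrier X \<Longrightarrow> f (gun X \<omega> x) = gun X \<omega> (f x)"
    and "\<And>m x y. m \<in> binops C \<Longrightarrow> x \<in> carrier X \<Longrightarrow> y \<in> carrier X \<Longrightarrow>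
      f (gbin X m x y) = gbin X m (f x) (f y)"
  shows "f \<in> gwo_hom C X X"
proof -
  have "f (\<boxminus> x) = \<boxminus> (f x)" if "x \<in> carrier X" for x
    using ext that by (intro additive_neg add) auto
  with assms show ?thesis by (simp add: gwo_hom_def)
qed

lemma inverse_endomorphism:
  assumes f: "f \<in> gwo_hom C X X" and bij: "bij_betw f (carrier X) (carrier X)"
  shows "restrict (inv_into (carrier X) f) (carrier X) \<in> gwo_hom C X X" (is "?g \<in> _")
proof -
  have gf: "?g (f x) = x" and f_closed: "f x \<in> carrier X" if "x \<in> carrier X" for x
    using that bij by (auto simp: bij_betw_def)
  have onto: "\<exists>x. x \<in> carrier X \<and> y = f x" if "y \<in> carrier X" for y
    using that bij by (auto simp: bij_betw_def)
  show ?thesis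
  proof (rule endomorphismI)
    show "?g \<in> carrier X \<rightarrow>\<^sub>E carrier X"
      using bij by (auto simp: bij_betw_def inv_into_into)
  next
    fix x y assume "x \<in> carrier X" "y \<in> carrier X"
    then obtain x' y' where "x' \<in> carrier X" "x = f x'" "y' \<in> carrier X" "y = f y'"
      using onto by metis
    moreover from this have "x \<boxplus> y = f (x' \<boxplus> y')"
      using f by (simp add: gwo_hom_def)
    ultimately show "?g (x \<boxplus> y) = ?g x \<boxplus> ?g y"
      by (simp only: gf closed)
  next
    fix \<omega> x assume \<omega>: "\<omega> \<in> unops C" and "x \<in> carrier X"
    then obtain x' where "x' \<in> carrier X" "x = f x'"
      using onto by metis
    moreover from this have "gun X \<omega> x = f (gun X \<omega> x')"
      using f \<omega> by (simp add: gwo_hom_def)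
    ultimately show "?g (gun X \<omega> x) = gun X \<omega> (?g x)"
      using \<omega> by (simp only: gf closed)
  next
    fix m x y assume m: "m \<in> binops C" and "x \<in> carrier X" "y \<in> carrier X"
    then obtain x' y' where "x' \<in> carrier X" "x = f x'" "y' \<in> carrier X" "y = f y'"
      using onto by metis
    moreover from this have "gbin X m x y = f (gbin X m x' y')"
      using f m by (simp add: gwo_hom_def)
    ultimately show "?g (gbin X m x y) = gbin X m (?g x) (?g y)"
      using m by (simp only: gf closed)
  qed
qed

lemma Aut_iff_mutually_inverse:
  "f \<in> carrier (Aut C X) \<longleftrightarrow> f \<in> gwo_hom C X X \<and>
     (\<exists>g \<in> gwo_hom C X X. \<forall>x \<in> carrier X. g (f x) = x \<and> f (g x) = x)"
proof -
  have "compose (carrier X) f g = (\<lambda>x \<in> carrier X. x) \<longleftrightarrow> (\<forall>x \<in> carrier X. f (g x) = x)"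
    for f g :: "'a \<Rightarrow> 'a"
    by (auto simp: compose_def fun_eq_iff restrict_def)
  then show ?thesis
    unfolding Aut_def units_of_def Units_def End_monoid_def by auto
qed

lemma Aut_iff_bij:
  "f \<in> carrier (Aut C X) \<longleftrightarrow> f \<in> gwo_hom C X X \<and> bij_betw f (carrier X) (carrier X)"
proof
  assume "f \<in> carrier (Aut C X)"
  then obtain g where g: "f \<in> gwo_hom C X X" "g \<in> gwo_hom C X X"
    "\<And>x. x \<in> carrier X \<Longrightarrow> g (f x) = x \<and> f (g x) = x"
    unfolding Aut_iff_mutually_inverse by blast
  then have "bij_betw f (carrier X) (carrier X)"
    by (intro bij_betw_byWitness[of _ g]) (auto simp: gwo_hom_def)
  with g show "f \<in> gwo_hom C X X \<and> bij_betw f (carrier X) (carrier X)" by simp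
next
  assume f: "f \<in> gwo_hom C X X \<and> bij_betw f (carrier X) (carrier X)"
  then have "f x \<in> carrier X" if "x \<in> carrier X" for x
    using that by (auto simp: gwo_hom_def)
  with f show "f \<in> carrier (Aut C X)"
    unfolding Aut_iff_mutually_inverse
    using inverse_endomorphism[of f]
    by (auto intro!: bexI[of _ "restrict (inv_into (carrier X) f) (carrier X)"]
        simp: bij_betw_inv_into_left bij_betw_inv_into_right)
qed

end


section \<open>Crossed modules through equations between the actions\<close>

text \<open>
  The split extension enters the argument only through three consequences: the actions are
  additive in the element of \<open>A\<close>, and the values of \<open>*\<close> and \<open>*\<degree>\<close> commute under \<open>+\<close>.  Isolating
  them leaves equations between elements of \<open>A\<close> and \<open>B\<close>.
\<close>

locale crossed_module_laws = A: gwo_object C A + B: gwo_object C B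
  for C :: "('u, 'v) op_theory" and A :: "('a, 'u, 'v) galgebra" and B :: "('b, 'u, 'v) galgebra" +
  fixes \<alpha> :: "'a \<Rightarrow> 'b" and dot :: "'b \<Rightarrow> 'a \<Rightarrow> 'a" and star :: "'v \<Rightarrow> 'b \<Rightarrow> 'a \<Rightarrow> 'a"
  assumes \<alpha>_hom: "\<alpha> \<in> gwo_hom C A B"
    and dot_closed [simp]: "b \<in> carrier B \<Longrightarrow> a \<in> carrier A \<Longrightarrow> dot b a \<in> carrier A"
    and star_closed [simp]:
      "m \<in> binops C \<Longrightarrow> b \<in> carrier B \<Longrightarrow> a \<in> carrier A \<Longrightarrow> star m b a \<in> carrier A"
    and dot_add: "b \<in> carrier B \<Longrightarrow> a \<in> carrier A \<Longrightarrow> a1 \<in> carrier A \<Longrightarrow>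
      dot b (a \<boxplus>\<^bsub>A\<^esub> a1) = dot b a \<boxplus>\<^bsub>A\<^esub> dot b a1"
    and star_add: "m \<in> binops C \<Longrightarrow> b \<in> carrier B \<Longrightarrow> a \<in> carrier A \<Longrightarrow> a1 \<in> carrier A \<Longrightarrow>
      star m b (a \<boxplus>\<^bsub>A\<^esub> a1) = star m b a \<boxplus>\<^bsub>A\<^esub> star m b a1"
    and star_commute: "m \<in> binops C \<Longrightarrow> m' \<in> {m, opp C m} \<Longrightarrow>
      b \<in> carrier B \<Longrightarrow> b1 \<in> carrier B \<Longrightarrow> a \<in> carrier A \<Longrightarrow> a1 \<in> carrier A \<Longrightarrow>
      star m' b a \<boxplus>\<^bsub>A\<^esub> star m b1 a1 = star m b1 a1 \<boxplus>\<^bsub>A\<^esub> star m' b a"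
    and \<alpha>_dot: "a \<in> carrier A \<Longrightarrow> b \<in> carrier B \<Longrightarrow>
      \<alpha> (dot b a) = b \<boxplus>\<^bsub>B\<^esub> \<alpha> a \<boxplus>\<^bsub>B\<^esub> (\<boxminus>\<^bsub>B\<^esub> b)"
    and dot_\<alpha>: "a \<in> carrier A \<Longrightarrow> a1 \<in> carrier A \<Longrightarrow>
      dot (\<alpha> a) a1 = a \<boxplus>\<^bsub>A\<^esub> a1 \<boxplus>\<^bsub>A\<^esub> (\<boxminus>\<^bsub>A\<^esub> a)"
    and \<alpha>_star: "m \<in> binops C \<Longrightarrow> a \<in> carrier A \<Longrightarrow> b \<in> carrier B \<Longrightarrow>
      \<alpha> (star m b a) = gbin B m b (\<alpha> a)"
    and star_\<alpha>: "m \<in> binops C \<Longrightarrow> a \<in> carrier A \<Longrightarrow> a1 \<in> carrier A \<Longrightarrow>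
      star m (\<alpha> a) a1 = gbin A m a a1"
begin

lemma \<alpha>_simps [simp]:
  "a \<in> carrier A \<Longrightarrow> \<alpha> a \<in> carrier B"
  "a \<in> carrier A \<Longrightarrow> a1 \<in> carrier A \<Longrightarrow> \<alpha> (a \<boxplus>\<^bsub>A\<^esub> a1) = \<alpha> a \<boxplus>\<^bsub>B\<^esub> \<alpha> a1"
  "a \<in> carrier A \<Longrightarrow> \<alpha> (\<boxminus>\<^bsub>A\<^esub> a) = \<boxminus>\<^bsub>B\<^esub> (\<alpha> a)"
  "\<omega> \<in> unops C \<Longrightarrow> a \<in> carrier A \<Longrightarrow> \<alpha> (gun A \<omega> a) = gun B \<omega> (\<alpha> a)"
  "m \<in> binops C \<Longrightarrow> a \<in> carrier A \<Longrightarrow> a1 \<in> carrier A \<Longrightarrow>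
    \<alpha> (gbin A m a a1) = gbin B m (\<alpha> a) (\<alpha> a1)"
  using \<alpha>_hom by (auto simp: gwo_hom_def)

lemma \<alpha>_zero [simp]: "\<alpha> (gzero A) = gzero B"
  using \<alpha>_simps(2)[of "gzero A" "gzero A"] by (intro B.idempotent_zero) auto

lemma dot_neg:
  assumes "b \<in> carrier B" "a \<in> carrier A"
  shows "dot b (\<boxminus>\<^bsub>A\<^esub> a) = \<boxminus>\<^bsub>A\<^esub> (dot b a)"
  using A.additive_neg[of "dot b" a] assms dot_add by simp

lemma star_neg:
  assumes "m \<in> binops C" "b \<in> carrier B" "a \<in> carrier A"
  shows "star m b (\<boxminus>\<^bsub>A\<^esub> a) = \<boxminus>\<^bsub>A\<^esub> (star m b a)"
  using A.additive_neg[of "star m b" a] assms star_add by simp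


section \<open>The two endomorphisms of a derivation\<close>

lemma DerI:
  assumes "f \<in> carrier B \<rightarrow>\<^sub>E carrier A"
    and "\<And>b b1. b \<in> carrier B \<Longrightarrow> b1 \<in> carrier B \<Longrightarrow> f (b \<boxplus>\<^bsub>B\<^esub> b1) = f b \<boxplus>\<^bsub>A\<^esub> dot b (f b1)"
    and "\<And>m b b1. m \<in> binops C \<Longrightarrow> b \<in> carrier B \<Longrightarrow> b1 \<in> carrier B \<Longrightarrow> f (gbin B m b b1) =
      gbin A m (f b) (f b1) \<boxplus>\<^bsub>A\<^esub> star (opp C m) b1 (f b) \<boxplus>\<^bsub>A\<^esub> star m b (f b1)"
    and "\<And>\<omega> b. \<omega> \<in> unops C \<Longrightarrow> b \<in> carrier B \<Longrightarrow> f (gun B \<omega> b) = gun A \<omega> (f b)"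
  shows "f \<in> Der C A B dot star"
  using assms by (simp add: Der_def rstar_def)

lemma Der_closed: "f \<in> Der C A B dot star \<Longrightarrow> b \<in> carrier B \<Longrightarrow> f b \<in> carrier A"
  by (auto simp: Der_def)

lemma \<sigma>_apply: "b \<in> carrier B \<Longrightarrow> \<sigma> B \<alpha> f b = \<alpha> (f b) \<boxplus>\<^bsub>B\<^esub> b"
  by (simp add: \<sigma>_def)

lemma \<sigma>_mult:
  assumes "f \<in> Der C A B dot star" "g \<in> Der C A B dot star" "b \<in> carrier B"
  shows "\<sigma> B \<alpha> (mult (Der_monoid C A B \<alpha> dot star) f g) b = \<sigma> B \<alpha> f (\<sigma> B \<alpha> g b)"
  using assms Der_closed[of f] Der_closed[of g] by (simp add: Der_monoid_def \<sigma>_apply)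

lemma \<sigma>_zero:
  "b \<in> carrier B \<Longrightarrow> \<sigma> B \<alpha> (one (Der_monoid C A B \<alpha> dot star)) b = b"
  by (simp add: Der_monoid_def \<sigma>_apply)

end

locale crossed_module_derivation = crossed_module_laws C A B \<alpha> dot star
  for C :: "('u, 'v) op_theory" and A :: "('a, 'u, 'v) galgebra" and B :: "('b, 'u, 'v) galgebra"
    and \<alpha> :: "'a \<Rightarrow> 'b" and dot :: "'b \<Rightarrow> 'a \<Rightarrow> 'a" and star :: "'v \<Rightarrow> 'b \<Rightarrow> 'a \<Rightarrow> 'a" +
  fixes d :: "'b \<Rightarrow> 'a"
  assumes derivation: "d \<in> Der C A B dot star"
begin

lemma d_closed [simp]: "b \<in> carrier B \<Longrightarrow> d b \<in> carrier A"
  using derivation by (rule Der_closed)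

lemma d_add: "b \<in> carrier B \<Longrightarrow> b1 \<in> carrier B \<Longrightarrow> d (b \<boxplus>\<^bsub>B\<^esub> b1) = d b \<boxplus>\<^bsub>A\<^esub> dot b (d b1)"
  using derivation by (simp add: Der_def)

lemma d_bin:
  "m \<in> binops C \<Longrightarrow> b \<in> carrier B \<Longrightarrow> b1 \<in> carrier B \<Longrightarrow> d (gbin B m b b1) =
    gbin A m (d b) (d b1) \<boxplus>\<^bsub>A\<^esub> (star (opp C m) b1 (d b) \<boxplus>\<^bsub>A\<^esub> star m b (d b1))"
  using derivation by (simp add: Der_def rstar_def)

lemma d_un: "\<omega> \<in> unops C \<Longrightarrow> b \<in> carrier B \<Longrightarrow> d (gun B \<omega> b) = gun A \<omega> (d b)"
  using derivation by (simp add: Der_def)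

text \<open>The action of \<open>0 = \<alpha> 0\<close> is conjugation by \<open>0\<close>, so \<open>d 0 + d 0 = d (0 + 0)\<close>.\<close>

lemma d_zero [simp]: "d (gzero B) = gzero A"
  using d_add[of "gzero B" "gzero B"] dot_\<alpha>[of "gzero A" "d (gzero B)"]
  by (intro A.idempotent_zero) auto

lemma d_\<alpha>_add:
  assumes "a \<in> carrier A" "b \<in> carrier B"
  shows "d (\<alpha> a \<boxplus>\<^bsub>B\<^esub> b) = d (\<alpha> a) \<boxplus>\<^bsub>A\<^esub> (a \<boxplus>\<^bsub>A\<^esub> (d b \<boxplus>\<^bsub>A\<^esub> (\<boxminus>\<^bsub>A\<^esub> a)))"
  using assms by (simp add: d_add dot_\<alpha>)

lemma \<theta>_apply: "a \<in> carrier A \<Longrightarrow> \<theta> A \<alpha> d a = d (\<alpha> a) \<boxplus>\<^bsub>A\<^esub> a"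
  by (simp add: \<theta>_def)

text \<open>
  For \<open>*\<close>, expand \<open>(\<alpha> (d b) + b) * (\<alpha> (d b1) + b1)\<close> in the first factor, then in the second: the
  summands then appear in the order of the derivation law, and nothing has to be commuted.  The
  same order of expansion works for \<open>\<theta>\<^sub>d\<close>.
\<close>

lemma \<sigma>_hom: "\<sigma> B \<alpha> d \<in> gwo_hom C B B"
proof (rule B.endomorphismI)
  fix m b b1 assume *: "m \<in> binops C" "b \<in> carrier B" "b1 \<in> carrier B"
  then show "\<sigma> B \<alpha> d (gbin B m b b1) = gbin B m (\<sigma> B \<alpha> d b) (\<sigma> B \<alpha> d b1)"
    by (simp add: \<sigma>_apply d_bin \<alpha>_star B.opp_bin del: B.bin_add_right) simp
qed (auto simp: \<sigma>_def d_add d_un \<alpha>_dot)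

lemma \<theta>_hom: "\<theta> A \<alpha> d \<in> gwo_hom C A A"
proof (rule A.endomorphismI)
  fix m a a1 assume *: "m \<in> binops C" "a \<in> carrier A" "a1 \<in> carrier A"
  then show "\<theta> A \<alpha> d (gbin A m a a1) = gbin A m (\<theta> A \<alpha> d a) (\<theta> A \<alpha> d a1)"
    by (simp add: \<theta>_apply d_bin star_\<alpha> A.opp_bin del: A.bin_add_right) simp
qed (auto simp: \<theta>_def d_\<alpha>_add d_un)

lemma \<theta>_closed [simp]: "a \<in> carrier A \<Longrightarrow> \<theta> A \<alpha> d a \<in> carrier A"
  using \<theta>_hom by (auto simp: gwo_hom_def)

lemma \<theta>_d: "b \<in> carrier B \<Longrightarrow> \<theta> A \<alpha> d (d b) = d (\<sigma> B \<alpha> d b)"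
  by (simp add: \<theta>_apply \<sigma>_apply d_\<alpha>_add)

text \<open>
  Both sides plus \<open>d b\<close> are \<open>d (b + \<alpha> a) + b \<cdot> a\<close>: split \<open>b + \<alpha> a\<close> as it stands, or as
  \<open>\<alpha> (b \<cdot> a) + b\<close>.
\<close>

lemma \<theta>_dot:
  assumes "b \<in> carrier B" "a \<in> carrier A"
  shows "\<theta> A \<alpha> d (dot b a) = d b \<boxplus>\<^bsub>A\<^esub> dot b (\<theta> A \<alpha> d a) \<boxplus>\<^bsub>A\<^esub> (\<boxminus>\<^bsub>A\<^esub> (d b))"
proof -
  have "\<alpha> (dot b a) \<boxplus>\<^bsub>B\<^esub> b = b \<boxplus>\<^bsub>B\<^esub> \<alpha> a"
    using assms by (simp add: \<alpha>_dot)
  then have "d (\<alpha> (dot b a)) \<boxplus>\<^bsub>A\<^esub> (dot b a \<boxplus>\<^bsub>A\<^esub> (d b \<boxplus>\<^bsub>A\<^esub> (\<boxminus>\<^bsub>A\<^esub> (dot b a)))) =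
      d b \<boxplus>\<^bsub>A\<^esub> dot b (d (\<alpha> a))"
    using assms by (simp flip: d_\<alpha>_add d_add)
  then have "d (\<alpha> (dot b a)) \<boxplus>\<^bsub>A\<^esub> (dot b a \<boxplus>\<^bsub>A\<^esub> (d b \<boxplus>\<^bsub>A\<^esub> (\<boxminus>\<^bsub>A\<^esub> (dot b a))))
        \<boxplus>\<^bsub>A\<^esub> dot b a \<boxplus>\<^bsub>A\<^esub> (\<boxminus>\<^bsub>A\<^esub> (d b)) =
      d b \<boxplus>\<^bsub>A\<^esub> dot b (d (\<alpha> a)) \<boxplus>\<^bsub>A\<^esub> dot b a \<boxplus>\<^bsub>A\<^esub> (\<boxminus>\<^bsub>A\<^esub> (d b))"
    by (rule arg_cong)
  then show ?thesis
    using assms by (simp add: \<theta>_apply dot_add)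
qed

lemma \<theta>_star:
  assumes "m \<in> binops C" "b \<in> carrier B" "a \<in> carrier A"
  shows "\<theta> A \<alpha> d (star m b a) = gbin A m (d b) (\<theta> A \<alpha> d a) \<boxplus>\<^bsub>A\<^esub> star m b (\<theta> A \<alpha> d a)"
  using assms by (simp add: \<theta>_apply \<alpha>_star d_bin star_\<alpha> A.opp_bin star_add)

lemma \<theta>_bij_if_\<sigma>_bij:
  assumes "bij_betw (\<sigma> B \<alpha> d) (carrier B) (carrier B)"
  shows "bij_betw (\<theta> A \<alpha> d) (carrier A) (carrier A)"
  unfolding bij_betw_def
proof
  have \<sigma>_inj: "inj_on (\<sigma> B \<alpha> d) (carrier B)" and \<sigma>_onto: "\<sigma> B \<alpha> d ` carrier B = carrier B"
    using assms by (auto simp: bij_betw_def)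
  have kernel: "a = gzero A" if a: "a \<in> carrier A" and "\<theta> A \<alpha> d a = gzero A" for a
  proof -
    have *: "d (\<alpha> a) \<boxplus>\<^bsub>A\<^esub> a = gzero A"
      using that by (simp add: \<theta>_apply)
    have "\<sigma> B \<alpha> d (\<alpha> a) = \<alpha> (d (\<alpha> a) \<boxplus>\<^bsub>A\<^esub> a)"
      using a by (simp add: \<sigma>_apply)
    also have "\<dots> = \<sigma> B \<alpha> d (gzero B)"
      by (simp add: * \<sigma>_apply)
    finally have "\<alpha> a = gzero B"
      using \<sigma>_inj a by (simp add: inj_on_eq_iff)
    with * a show ?thesis by simp
  qed
  show "inj_on (\<theta> A \<alpha> d) (carrier A)"
  proof (rule inj_onI)
    fix a a1 assume *: "a \<in> carrier A" "a1 \<in> carrier A" "\<theta> A \<alpha> d a = \<theta> A \<alpha> d a1"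
    then have "\<theta> A \<alpha> d (a \<boxplus>\<^bsub>A\<^esub> (\<boxminus>\<^bsub>A\<^esub> a1)) = gzero A"
      using \<theta>_hom by (simp add: gwo_hom_def)
    then have "\<boxminus>\<^bsub>A\<^esub> a1 = \<boxminus>\<^bsub>A\<^esub> a"
      using * kernel[of "a \<boxplus>\<^bsub>A\<^esub> (\<boxminus>\<^bsub>A\<^esub> a1)"] by (intro A.neg_unique) simp_all
    then have "\<boxminus>\<^bsub>A\<^esub> (\<boxminus>\<^bsub>A\<^esub> a1) = \<boxminus>\<^bsub>A\<^esub> (\<boxminus>\<^bsub>A\<^esub> a)"
      by (rule arg_cong)
    then show "a = a1"
      using * by simp
  qed
  show "\<theta> A \<alpha> d ` carrier A = carrier A"
  proof
    show "\<theta> A \<alpha> d ` carrier A \<subseteq> carrier A" by auto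
    show "carrier A \<subseteq> \<theta> A \<alpha> d ` carrier A"
    proof
      fix a assume a: "a \<in> carrier A"
      then obtain b where b: "b \<in> carrier B" "\<alpha> a = \<alpha> (d b) \<boxplus>\<^bsub>B\<^esub> b"
        using \<sigma>_onto \<sigma>_apply by (metis \<alpha>_simps(1) imageE)
      then have "\<alpha> ((\<boxminus>\<^bsub>A\<^esub> (d b)) \<boxplus>\<^bsub>A\<^esub> a) = b"
        using a by simp
      then have "\<theta> A \<alpha> d ((\<boxminus>\<^bsub>A\<^esub> (d b)) \<boxplus>\<^bsub>A\<^esub> a) = a"
        using a b(1) by (simp add: \<theta>_apply del: \<alpha>_simps)
      then show "a \<in> \<theta> A \<alpha> d ` carrier A"
        using a b(1) by (metis A.closed(2,3) d_closed image_eqI)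
    qed
  qed
qed


section \<open>Inverting a derivation\<close>

context
  fixes e :: "'b \<Rightarrow> 'a"
  assumes \<theta>_inj: "inj_on (\<theta> A \<alpha> d) (carrier A)"
    and e_ext: "e \<in> carrier B \<rightarrow>\<^sub>E carrier A"
    and \<theta>_e: "\<And>b. b \<in> carrier B \<Longrightarrow> \<theta> A \<alpha> d (e b) = \<boxminus>\<^bsub>A\<^esub> (d b)"
begin

lemma e_closed [simp]: "b \<in> carrier B \<Longrightarrow> e b \<in> carrier A"
  using e_ext by auto

lemma \<theta>_eqD:
  "\<theta> A \<alpha> d x = \<theta> A \<alpha> d y \<Longrightarrow> x \<in> carrier A \<Longrightarrow> y \<in> carrier A \<Longrightarrow> x = y"
  using \<theta>_inj by (rule inj_onD)

text \<open>
  For \<open>*\<close>, write \<open>P = d b * d b1\<close>, \<open>Q = d b * b1\<close>, \<open>R = b * d b1\<close>.  Applied to the right-hand side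
  of the law, \<open>\<theta>\<^sub>d\<close> gives \<open>P + (- P - Q) + (- P - R) = - (R + P + Q)\<close>, while the left-hand side
  gives \<open>- (P + Q + R)\<close>; so \<open>R\<close> has to be moved past \<open>P\<close> and \<open>Q\<close>.
\<close>

lemma inverse_derivation: "e \<in> Der C A B dot star"
proof (rule DerI)
  have \<theta>_add: "\<theta> A \<alpha> d (x \<boxplus>\<^bsub>A\<^esub> y) = \<theta> A \<alpha> d x \<boxplus>\<^bsub>A\<^esub> \<theta> A \<alpha> d y"
    if "x \<in> carrier A" "y \<in> carrier A" for x y
    using that \<theta>_hom by (simp add: gwo_hom_def)
  show "e \<in> carrier B \<rightarrow>\<^sub>E carrier A" by (rule e_ext)
  fix b assume b: "b \<in> carrier B"
  { fix b1 assume b1: "b1 \<in> carrier B"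
    show "e (b \<boxplus>\<^bsub>B\<^esub> b1) = e b \<boxplus>\<^bsub>A\<^esub> dot b (e b1)"
      using b b1 by - (rule \<theta>_eqD; simp add: \<theta>_add \<theta>_e \<theta>_dot d_add dot_neg)
    fix m assume m: "m \<in> binops C"
    let ?P = "gbin A m (d b) (d b1)" and ?Q = "star (opp C m) b1 (d b)" and ?R = "star m b (d b1)"
    have carr: "?P \<in> carrier A" "?Q \<in> carrier A" "?R \<in> carrier A"
      using b b1 m by auto
    \<comment> \<open>\<open>?P\<close> is itself a value of the action by \<open>*\<close>, since \<open>d b\<close> multiplies as \<open>\<alpha> (d b)\<close> acts.\<close>
    have PR: "?P \<boxplus>\<^bsub>A\<^esub> ?R = ?R \<boxplus>\<^bsub>A\<^esub> ?P"
      using star_commute[of m m "\<alpha> (d b)" b "d b1" "d b1"] b b1 m by (simp add: star_\<alpha>)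
    have QR: "?Q \<boxplus>\<^bsub>A\<^esub> ?R = ?R \<boxplus>\<^bsub>A\<^esub> ?Q"
      using star_commute[of m "opp C m" b1 b "d b" "d b1"] b b1 m by simp
    have "\<theta> A \<alpha> d (gbin A m (e b) (e b1) \<boxplus>\<^bsub>A\<^esub> star (opp C m) b1 (e b) \<boxplus>\<^bsub>A\<^esub> star m b (e b1)) =
        ?P \<boxplus>\<^bsub>A\<^esub> ((\<boxminus>\<^bsub>A\<^esub> ?P) \<boxplus>\<^bsub>A\<^esub> (\<boxminus>\<^bsub>A\<^esub> ?Q)) \<boxplus>\<^bsub>A\<^esub> ((\<boxminus>\<^bsub>A\<^esub> ?P) \<boxplus>\<^bsub>A\<^esub> (\<boxminus>\<^bsub>A\<^esub> ?R))"
    proof -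
      have "\<theta> A \<alpha> d (gbin A m (e b) (e b1)) = gbin A m (\<theta> A \<alpha> d (e b)) (\<theta> A \<alpha> d (e b1))"
        using \<theta>_hom b b1 m by (simp add: gwo_hom_def)
      then show ?thesis
        using b b1 m by (simp add: \<theta>_add \<theta>_star \<theta>_e A.opp_bin star_neg)
    qed
    also have "\<dots> = \<boxminus>\<^bsub>A\<^esub> (?R \<boxplus>\<^bsub>A\<^esub> (?P \<boxplus>\<^bsub>A\<^esub> ?Q))"
      using carr by simp
    also have "?R \<boxplus>\<^bsub>A\<^esub> (?P \<boxplus>\<^bsub>A\<^esub> ?Q) = ?P \<boxplus>\<^bsub>A\<^esub> (?Q \<boxplus>\<^bsub>A\<^esub> ?R)"
      using carr PR QR by (metis A.assoc)
    finally show "e (gbin B m b b1) =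
        gbin A m (e b) (e b1) \<boxplus>\<^bsub>A\<^esub> star (opp C m) b1 (e b) \<boxplus>\<^bsub>A\<^esub> star m b (e b1)"
      using b b1 m by - (rule \<theta>_eqD; simp add: \<theta>_e d_bin) }
  fix \<omega> assume \<omega>: "\<omega> \<in> unops C"
  have "\<theta> A \<alpha> d (gun A \<omega> (e b)) = gun A \<omega> (\<theta> A \<alpha> d (e b))"
    using \<theta>_hom \<omega> b by (simp add: gwo_hom_def)
  then show "e (gun B \<omega> b) = gun A \<omega> (e b)"
    using \<omega> b by - (rule \<theta>_eqD; simp add: \<theta>_e d_un)
qed

lemma left_inverse: "b \<in> carrier B \<Longrightarrow> e (\<sigma> B \<alpha> d b) \<boxplus>\<^bsub>A\<^esub> d b = gzero A"
proof -
  assume b: "b \<in> carrier B"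
  have "e (\<sigma> B \<alpha> d b) = \<boxminus>\<^bsub>A\<^esub> (d b)"
  proof (rule \<theta>_eqD)
    have "\<theta> A \<alpha> d (\<boxminus>\<^bsub>A\<^esub> (d b)) = \<boxminus>\<^bsub>A\<^esub> (\<theta> A \<alpha> d (d b))"
      using \<theta>_hom b by (simp add: gwo_hom_def)
    then show "\<theta> A \<alpha> d (e (\<sigma> B \<alpha> d b)) = \<theta> A \<alpha> d (\<boxminus>\<^bsub>A\<^esub> (d b))"
      using b by (simp add: \<theta>_e \<theta>_d \<sigma>_apply)
  qed (use b in \<open>auto simp: \<sigma>_apply\<close>)
  then show ?thesis using b by simp
qed

lemma right_inverse: "b \<in> carrier B \<Longrightarrow> d (\<sigma> B \<alpha> e b) \<boxplus>\<^bsub>A\<^esub> e b = gzero A"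
proof -
  assume b: "b \<in> carrier B"
  have "d (\<sigma> B \<alpha> e b) \<boxplus>\<^bsub>A\<^esub> e b = \<theta> A \<alpha> d (e b) \<boxplus>\<^bsub>A\<^esub> d b"
    using b by (simp add: \<sigma>_apply d_\<alpha>_add \<theta>_apply)
  then show ?thesis using b by (simp add: \<theta>_e)
qed

end

lemma regular_if_\<theta>_bij:
  assumes "bij_betw (\<theta> A \<alpha> d) (carrier A) (carrier A)"
  shows "d \<in> Units (Der_monoid C A B \<alpha> dot star)"
proof -
  define e where "e = (\<lambda>b \<in> carrier B. inv_into (carrier A) (\<theta> A \<alpha> d) (\<boxminus>\<^bsub>A\<^esub> (d b)))"
  have inj: "inj_on (\<theta> A \<alpha> d) (carrier A)"
    using assms by (simp add: bij_betw_def)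
  have ext: "e \<in> carrier B \<rightarrow>\<^sub>E carrier A"
    using assms by (auto simp: e_def bij_betw_def inv_into_into)
  have \<theta>_e: "\<theta> A \<alpha> d (e b) = \<boxminus>\<^bsub>A\<^esub> (d b)" if "b \<in> carrier B" for b
    using that assms by (simp add: e_def bij_betw_inv_into_right)
  note * = inj ext \<theta>_e
  show ?thesis
    unfolding Units_def Der_monoid_def
    using derivation inverse_derivation[OF *] left_inverse[OF *] right_inverse[OF *]
    by (auto simp: fun_eq_iff restrict_def intro!: bexI[of _ e])
qed

lemma \<sigma>_Aut_if_regular:
  assumes "d \<in> Units (Der_monoid C A B \<alpha> dot star)"
  shows "\<sigma> B \<alpha> d \<in> carrier (Aut C B)"
proof -
  let ?D = "Der_monoid C A B \<alpha> dot star"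
  obtain e where e: "e \<in> Der C A B dot star" "mult ?D e d = one ?D" "mult ?D d e = one ?D"
    using assms by (auto simp: Units_def Der_monoid_def)
  interpret e: crossed_module_derivation C A B \<alpha> dot star e
    by unfold_locales (rule e)
  have "\<sigma> B \<alpha> e (\<sigma> B \<alpha> d b) = b \<and> \<sigma> B \<alpha> d (\<sigma> B \<alpha> e b) = b" if b: "b \<in> carrier B" for b
    using \<sigma>_mult[OF e(1) derivation b] \<sigma>_mult[OF derivation e(1) b] \<sigma>_zero[OF b] e(2,3) by simp
  then show ?thesis
    unfolding B.Aut_iff_mutually_inverse using \<sigma>_hom e.\<sigma>_hom by blast
qed

end


section \<open>Derived actions satisfy the equations\<close>

text \<open>
  All equations are checked in the extension, where \<open>\<cdot>\<close> is conjugation and the actions by \<open>*\<close>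
  are values of \<open>*\<close>; the embedding of \<open>A\<close> is injective.
\<close>

lemma crossed_module_satisfies_laws:
  fixes C :: "('u, 'v) op_theory"
    and A :: "('a, 'u, 'v) galgebra" and B :: "('b, 'u, 'v) galgebra"
  assumes gwo: "groups_with_operations C"
    and cm: "crossed_module TYPE('e) C A B \<alpha> dot star"
  shows "crossed_module_laws C A B \<alpha> dot star"
proof -
  interpret A: gwo_object C A
    by unfold_locales (use gwo cm in \<open>auto simp: crossed_module_def\<close>)
  interpret B: gwo_object C B
    by unfold_locales (use gwo cm in \<open>auto simp: crossed_module_def\<close>)
  have "derived_actions TYPE('e) C A B dot star"
    using cm by (simp add: crossed_module_def)
  then obtain E :: "('e, 'u, 'v) galgebra" and i p s where
    ext: "split_extension C A E B i p s"
    and dots: "\<forall>b \<in> carrier B. \<forall>a \<in> carrier A. dot b a \<in> carrier A \<and>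
           i (dot b a) = s b \<boxplus>\<^bsub>E\<^esub> i a \<boxplus>\<^bsub>E\<^esub> (\<boxminus>\<^bsub>E\<^esub> (s b))"
    and stars: "\<forall>m \<in> binops C. \<forall>b \<in> carrier B. \<forall>a \<in> carrier A.
           star m b a \<in> carrier A \<and> i (star m b a) = gbin E m (s b) (i a)"
    unfolding derived_actions_def by (elim exE conjE) rule
  note dot = dots[rule_format] and star = stars[rule_format]
  interpret E: gwo_object C E
    by unfold_locales (use gwo ext in \<open>auto simp: split_extension_def\<close>)
  have i: "a \<in> carrier A \<Longrightarrow> i a \<in> carrier E"
    "a \<in> carrier A \<Longrightarrow> a1 \<in> carrier A \<Longrightarrow> i (a \<boxplus>\<^bsub>A\<^esub> a1) = i a \<boxplus>\<^bsub>E\<^esub> i a1" for a a1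
    using ext by (auto simp: split_extension_def gwo_hom_def)
  have s: "b \<in> carrier B \<Longrightarrow> s b \<in> carrier E" for b
    using ext by (auto simp: split_extension_def gwo_hom_def)
  have i_eqD: "i x = i y \<Longrightarrow> x \<in> carrier A \<Longrightarrow> y \<in> carrier A \<Longrightarrow> x = y" for x y
    using ext by (auto simp: split_extension_def dest: inj_onD)
  show ?thesis
  proof unfold_locales
    fix b a a1 assume "b \<in> carrier B" "a \<in> carrier A" "a1 \<in> carrier A"
    then show "dot b (a \<boxplus>\<^bsub>A\<^esub> a1) = dot b a \<boxplus>\<^bsub>A\<^esub> dot b a1"
      by - (rule i_eqD; simp add: dot i s)
  next
    fix m b a a1 assume "m \<in> binops C" "b \<in> carrier B" "a \<in> carrier A" "a1 \<in> carrier A"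
    then show "star m b (a \<boxplus>\<^bsub>A\<^esub> a1) = star m b a \<boxplus>\<^bsub>A\<^esub> star m b a1"
      by - (rule i_eqD; simp add: star i s)
  next
    fix m m' b b1 a a1
    assume *: "m \<in> binops C" "m' \<in> {m, opp C m}" "b \<in> carrier B" "b1 \<in> carrier B"
      "a \<in> carrier A" "a1 \<in> carrier A"
    show "star m' b a \<boxplus>\<^bsub>A\<^esub> star m b1 a1 = star m b1 a1 \<boxplus>\<^bsub>A\<^esub> star m' b a"
    proof (cases "m' = m")
      case True
      then show ?thesis
        using * E.bin_commute[of m "s b" "s b1" "i a1" "i a"]
        by - (rule i_eqD; simp add: star i s)
    next
      case False
      then have "m' = opp C m" using * by simp
      then show ?thesis
        using * E.bin_commute[of m "i a" "s b1" "i a1" "s b"]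
        by - (rule i_eqD; simp add: star i s E.opp_bin)
    qed
  qed (use cm dot star in \<open>auto simp: crossed_module_def\<close>)
qed


section \<open>Regular derivations\<close>

theorem proposition4p4:
  fixes C :: "('u, 'v) op_theory"
    and A :: "('a, 'u, 'v) galgebra"
    and B :: "('b, 'u, 'v) galgebra"
    and \<alpha> :: "'a \<Rightarrow> 'b"
    and dot :: "'b \<Rightarrow> 'a \<Rightarrow> 'a"
    and star :: "'v \<Rightarrow> 'b \<Rightarrow> 'a \<Rightarrow> 'a"
    and d :: "'b \<Rightarrow> 'a"
  assumes "groups_with_operations C"
    and "crossed_module TYPE('e) C A B \<alpha> dot star"
    and "d \<in> Der C A B dot star"
  shows "(d \<in> carrier (Whitehead_group C A B \<alpha> dot star) \<longleftrightarrow> \<theta> A \<alpha> d \<in> carrier (Aut C A)) \<and>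
         (\<theta> A \<alpha> d \<in> carrier (Aut C A) \<longleftrightarrow> \<sigma> B \<alpha> d \<in> carrier (Aut C B))"
proof -
  interpret laws: crossed_module_laws C A B \<alpha> dot star
    using assms(1,2) by (rule crossed_module_satisfies_laws)
  interpret crossed_module_derivation C A B \<alpha> dot star d
    by unfold_locales (rule assms(3))
  have "\<theta> A \<alpha> d \<in> carrier (Aut C A)" if "\<sigma> B \<alpha> d \<in> carrier (Aut C B)"
    using that \<theta>_hom \<theta>_bij_if_\<sigma>_bij by (simp add: laws.A.Aut_iff_bij laws.B.Aut_iff_bij)
  moreover have "d \<in> Units (Der_monoid C A B \<alpha> dot star)" if "\<theta> A \<alpha> d \<in> carrier (Aut C A)"
    using that regular_if_\<theta>_bij by (simp add: laws.A.Aut_iff_bij)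
  ultimately show ?thesis
    using \<sigma>_Aut_if_regular by (auto simp: Whitehead_group_def units_of_def)
qed

end
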